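(* Let $t\ge 2$ be an even integer, let $T$ be a complete full $t$-ary tree (with at least one edge), and let $l$ be the number of leaves of $T$. Then the local antimagic chromatic number $\chi_{la}(T)$ is either $l+1$ or $l+2$.
   Context: For an integer $t\ge 2$, a complete full $t$-ary tree is a (finite) rooted tree in which every node other than the leaves has exactly $t$ children and all leaves have the same depth. The leaves are the vertices of degree one, i.e. the nodes without children. (If the common depth is $n\ge 1$, there are $t^n$ leaves.) Let $G=(V,E)$ be a finite simple undirected graph without isolated vertices and without components isomorphic to $K_2$. For a bijection $f:E\to\{1,2,\dots,|E|\}$ and $u\in V$, the vertex sum (weight, color) of $u$ is $w(u)=\sum_{e\in E(u)}f(e)$, where $E(u)$ is the set of edges incident to $u$. The bijection $f$ is called a local antimagic labeling of $G$ if $w(u)\ne w(v)$ for every two adjacent vertices $u,v$. Such an $f$ induces a proper vertex coloring of $G$ in which $v$ receives the color $w(v)$; the number of colors is the number of distinct values of $w$. The local antimagic chromatic number $\chi_{la}(G)$ is the minimum number of colors over all colorings induced by local antimagic labelings of $G$. *)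

theory Defs
  imports Main
begin

text \<open>A graph is given by its vertex set and its edge set; edges are two-element sets of vertices.\<close>

definition simple_graph :: "'a set \<Rightarrow> 'a set set \<Rightarrow> bool" where
  "simple_graph V E \<longleftrightarrow> finite V \<and> (\<forall>e\<in>E. e \<subseteq> V \<and> card e = 2)"

definition incident_edges :: "'a set set \<Rightarrow> 'a \<Rightarrow> 'a set set" where
  "incident_edges E v = {e \<in> E. v \<in> e}"

definition degree :: "'a set set \<Rightarrow> 'a \<Rightarrow> nat" where
  "degree E v = card (incident_edges E v)"

text \<open>The singleton list is the trivial walk, with zero edges.\<close>

definition walk :: "'a set \<Rightarrow> 'a set set \<Rightarrow> 'a list \<Rightarrow> bool" where
  "walk V E p \<longleftrightarrow> p \<noteq> [] \<and> set p \<subseteq> V \<and> successively (\<lambda>u v. {u, v} \<in> E) p"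

definition walk_between :: "'a set \<Rightarrow> 'a set set \<Rightarrow> 'a \<Rightarrow> 'a list \<Rightarrow> 'a \<Rightarrow> bool" where
  "walk_between V E u p v \<longleftrightarrow> walk V E p \<and> hd p = u \<and> last p = v"

definition connected_graph :: "'a set \<Rightarrow> 'a set set \<Rightarrow> bool" where
  "connected_graph V E \<longleftrightarrow> V \<noteq> {} \<and> (\<forall>u\<in>V. \<forall>v\<in>V. \<exists>p. walk_between V E u p v)"

text \<open>A cycle is listed without repeating its first vertex at the end.\<close>

definition graph_cycle :: "'a set \<Rightarrow> 'a set set \<Rightarrow> 'a list \<Rightarrow> bool" where
  "graph_cycle V E p \<longleftrightarrow>
     walk V E p \<and> distinct p \<and> 3 \<le> length p \<and> {last p, hd p} \<in> E"

definition tree :: "'a set \<Rightarrow> 'a set set \<Rightarrow> bool" where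
  "tree V E \<longleftrightarrow> simple_graph V E \<and> connected_graph V E \<and> (\<nexists>p. graph_cycle V E p)"

text \<open>The depth of a vertex is its distance from the root \<open>r\<close>; a walk with \<open>n\<close> edges is a list of
  length \<open>Suc n\<close>. The value is meaningful only if the vertex is reachable from \<open>r\<close>.\<close>

definition depth :: "'a set \<Rightarrow> 'a set set \<Rightarrow> 'a \<Rightarrow> 'a \<Rightarrow> nat" where
  "depth V E r v = (LEAST n. \<exists>p. walk_between V E r p v \<and> length p = Suc n)"

definition children :: "'a set \<Rightarrow> 'a set set \<Rightarrow> 'a \<Rightarrow> 'a \<Rightarrow> 'a set" where
  "children V E r v = {u \<in> V. {v, u} \<in> E \<and> depth V E r u = Suc (depth V E r v)}"

definition leaves :: "'a set \<Rightarrow> 'a set set \<Rightarrow> 'a set" where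
  "leaves V E = {v \<in> V. degree E v = 1}"

text \<open>Since leaves are the vertices of degree one, the one-vertex tree is not covered for
  \<open>t > 0\<close>. A root of degree one is excluded as well (for \<open>t \<ge> 2\<close>): it would be a leaf of depth
  zero, while some other leaf has positive depth.\<close>

definition complete_full_tree :: "nat \<Rightarrow> 'a set \<Rightarrow> 'a set set \<Rightarrow> 'a \<Rightarrow> bool" where
  "complete_full_tree t V E r \<longleftrightarrow>
     tree V E \<and> r \<in> V \<and>
     (\<forall>v \<in> V - leaves V E. card (children V E r v) = t) \<and>
     (\<forall>u \<in> leaves V E. \<forall>v \<in> leaves V E. depth V E r u = depth V E r v)"

definition weight :: "'a set set \<Rightarrow> ('a set \<Rightarrow> nat) \<Rightarrow> 'a \<Rightarrow> nat" where
  "weight E f v = (\<Sum>e \<in> incident_edges E v. f e)"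

definition local_antimagic :: "'a set set \<Rightarrow> ('a set \<Rightarrow> nat) \<Rightarrow> bool" where
  "local_antimagic E f \<longleftrightarrow>
     bij_betw f E {1..card E} \<and> (\<forall>u v. {u, v} \<in> E \<longrightarrow> weight E f u \<noteq> weight E f v)"

text \<open>On \<open>nat\<close>, \<open>Inf\<close> of a nonempty set is its minimum and \<open>Inf {} = 0\<close>. Hence a positive value
  entails that a local antimagic labeling exists and that the minimum is attained.\<close>

definition local_antimagic_chromatic_number :: "'a set \<Rightarrow> 'a set set \<Rightarrow> nat" where
  "local_antimagic_chromatic_number V E =
     Inf {card (weight E f ` V) | f. local_antimagic E f}"

end

theory Submission imports Defs "HOL-Library.Disjoint_Sets" begin

text \<open>Lower bound: distinct leaves carry distinct labels, hence distinct weights, all of them at most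
  \<open>card E\<close>. The edge with label \<open>card E\<close> has an endpoint with a further incident edge, so that
  the weight of this endpoint exceeds \<open>card E\<close> and is one more colour (\<open>card_colours_ge\<close>).

  Upper bound: let \<open>t = 2 * s\<close>, let \<open>n\<close> be the common depth of the leaves, and let \<open>U\<close> be the
  number of edges that do not end in a leaf. There are \<open>U + 1\<close> internal vertices, and every edge
  leads from exactly one of them to a child, so \<open>card E = 2 * s * (U + 1)\<close>. For \<open>n = 1\<close> the tree
  is a star, and any labelling will do. For \<open>n\<close> at least 2, label the non-leaf edges with
  \<open>1..U\<close> and the leaf edges with \<open>U + 1..card E\<close>.

  Among the children of a vertex of depth at most \<open>n - 2\<close>, the labels of the edges are grouped
  into \<open>s\<close> pairs with sum \<open>U + 1\<close>. The weight of such a vertex is then \<open>s * (U + 1)\<close> plus the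
  label of the edge to its parent, if there is one. These weights are pairwise distinct and lie
  between \<open>U + 1\<close> and \<open>card E\<close>; each of them is therefore also the weight of a leaf, and no
  new colour arises.

  There remain the \<open>m\<close> vertices of depth \<open>n - 1\<close>. The pairs are distributed so that the edges
  above these vertices get consecutive labels \<open>c, c + 1, ..., c + m - 1\<close>. Since \<open>m\<close> is even, no
  choice of leaf labels makes all \<open>m\<close> weights equal, but two values that differ by 1 can be
  achieved: the leaf labels can be partitioned into \<open>m\<close> sets of size \<open>t\<close> so that set number
  \<open>x\<close> has sum \<open>C - x\<close> or \<open>C - x + 1\<close> (\<open>leaf_label_sets\<close>). Both weights exceed \<open>card E\<close>, and
  adjacent vertices get different weights. Altogether the leaf colours and two further ones
  suffice (\<open>deep_labelling\<close>).\<close>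

section \<open>Walks and parents in a rooted tree\<close>

lemma walk_rev: "walk V E p \<Longrightarrow> walk V E (rev p)"
  by (simp add: walk_def insert_commute)

lemma walk_join:
  assumes "walk V E p" "walk V E q" "last p = hd q"
  shows "walk V E (p @ tl q)"
proof (cases q)
  case Nil
  then show ?thesis using assms by simp
next
  case (Cons a q')
  then show ?thesis using assms
    by (cases q') (auto simp: walk_def successively_append_iff)
qed

lemma distinct_walk:
  assumes "walk_between V E u p v"
  shows "\<exists>p'. walk_between V E u p' v \<and> distinct p' \<and> set p' \<subseteq> set p"
  using assms
proof (induction "length p" arbitrary: p rule: less_induct)
  case less
  show ?case
  proof (cases "distinct p")
    case True
    then show ?thesis using less.prems by blast
  next
    case False
    then obtain xs ys zs y where p: "p = xs @ [y] @ ys @ [y] @ zs"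
      using not_distinct_decomp by blast
    let ?p = "xs @ [y] @ zs"
    have w: "walk_between V E u ?p v"
      using less.prems unfolding p walk_between_def walk_def
      by (auto simp: successively_append_iff successively_Cons hd_append split: if_splits)
    have "length ?p < length p" by (simp add: p)
    from less.hyps[OF this w] obtain p'
      where "walk_between V E u p' v" "distinct p'" "set p' \<subseteq> set ?p" by blast
    then show ?thesis by (auto simp: p)
  qed
qed

lemma depth_le:
  assumes "walk_between V E r p v" "length p = Suc k"
  shows "depth V E r v \<le> k"
  unfolding depth_def by (rule Least_le) (use assms in blast)

lemma shortest_walk:
  assumes "connected_graph V E" "r \<in> V" "v \<in> V"
  obtains p where "walk_between V E r p v" "length p = Suc (depth V E r v)"
    "\<And>w. w \<in> set p \<Longrightarrow> w = v \<or> depth V E r w < depth V E r v"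
proof -
  obtain p0 where p0: "walk_between V E r p0 v"
    using assms unfolding connected_graph_def by blast
  then have "length p0 = Suc (length p0 - 1)"
    by (cases p0) (auto simp: walk_between_def walk_def)
  with p0 have "\<exists>n p. walk_between V E r p v \<and> length p = Suc n" by blast
  then have "\<exists>p. walk_between V E r p v \<and> length p = Suc (depth V E r v)"
    unfolding depth_def by (rule LeastI_ex)
  then obtain p where p: "walk_between V E r p v" and l: "length p = Suc (depth V E r v)" by blast
  have "w = v \<or> depth V E r w < depth V E r v" if w: "w \<in> set p" for w
  proof -
    obtain i where i: "i < length p" "w = p ! i" using w by (auto simp: in_set_conv_nth)
    let ?q = "take (Suc i) p"
    have "walk_between V E r ?q w"
    proof -
      have "p = ?q @ drop (Suc i) p" by simp
      then have "successively (\<lambda>u v. {u, v} \<in> E) ?q"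
        using p unfolding walk_between_def walk_def by (metis successively_append_iff)
      moreover have "set ?q \<subseteq> V" using p set_take_subset[of "Suc i" p]
        unfolding walk_between_def walk_def by blast
      moreover have "last ?q = w" using i by (simp add: take_Suc_conv_app_nth)
      ultimately show ?thesis using p by (auto simp: walk_between_def walk_def)
    qed
    then have le: "depth V E r w \<le> i" by (rule depth_le) (use i in simp)
    show ?thesis
    proof (cases "i = depth V E r v")
      case True
      then have "w = v" using i l p unfolding walk_between_def walk_def
        by (metis diff_Suc_1 last_conv_nth)
      then show ?thesis ..
    next
      case False
      then show ?thesis using le i l by linarith
    qed
  qed
  then show ?thesis using that p l by blast
qed

lemma depth_root: "r \<in> V \<Longrightarrow> depth V E r r = 0"
  using depth_le[of V E r "[r]" r 0] by (simp add: walk_between_def walk_def)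

lemma tree_edge:
  assumes "tree V E" "{u, v} \<in> E"
  shows "u \<in> V" "v \<in> V" "u \<noteq> v"
  using assms unfolding tree_def simple_graph_def by force+

lemma depth_0:
  assumes "tree V E" "r \<in> V" "v \<in> V" "depth V E r v = 0"
  shows "v = r"
proof -
  obtain p where "walk_between V E r p v" "length p = Suc (depth V E r v)"
    using shortest_walk assms unfolding tree_def by metis
  then show ?thesis using assms(4)
    by (cases p) (auto simp: walk_between_def)
qed

text \<open>The parent of a vertex is its only neighbour that is no deeper. Two different neighbours of \<open>x\<close> that are no deeper than \<open>x\<close> are joined through the root by a
  walk avoiding \<open>x\<close>, which closes up to a cycle at \<open>x\<close>.\<close>

lemma upper_neighbour_unique:
  assumes T: "tree V E" and r: "r \<in> V"
    and y: "{x, y} \<in> E" "depth V E r y \<le> depth V E r x"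
    and z: "{x, z} \<in> E" "depth V E r z \<le> depth V E r x"
  shows "y = z"
proof (rule ccontr)
  assume ne: "y \<noteq> z"
  have C: "connected_graph V E" using T by (simp add: tree_def)
  note ey = tree_edge[OF T y(1)] and ez = tree_edge[OF T z(1)]
  obtain p where p: "walk_between V E r p y"
    "\<And>w. w \<in> set p \<Longrightarrow> w = y \<or> depth V E r w < depth V E r y"
    using shortest_walk[OF C r ey(2)] by metis
  obtain q where q: "walk_between V E r q z"
    "\<And>w. w \<in> set q \<Longrightarrow> w = z \<or> depth V E r w < depth V E r z"
    using shortest_walk[OF C r ez(2)] by metis
  have xp: "x \<notin> set p" using p(2)[of x] y(2) ey(3) by auto
  have xq: "x \<notin> set q" using q(2)[of x] z(2) ez(3) by auto
  have lq: "last (rev p @ tl q) = z"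
    using p(1) q(1) by (cases q) (auto simp: walk_between_def walk_def last_rev)
  have "walk V E (rev p @ tl q)"
    using p(1) q(1) by (intro walk_join walk_rev) (auto simp: walk_between_def last_rev walk_def)
  then have "walk_between V E y (rev p @ tl q) z"
    using p(1) lq by (auto simp: walk_between_def walk_def hd_rev)
  from distinct_walk[OF this] obtain c where
    c: "walk_between V E y c z" "distinct c" "set c \<subseteq> set (rev p @ tl q)" by blast
  have xc: "x \<notin> set c" using c(3) xp xq by (cases q) auto
  obtain a c' where cc: "c = a # c'" using c(1) by (cases c) (auto simp: walk_between_def walk_def)
  have c': "c' \<noteq> []" using c(1) ne cc by (auto simp: walk_between_def)
  have "graph_cycle V E (x # c)"
    unfolding graph_cycle_def
  proof (intro conjI)
    show "walk V E (x # c)"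
      using c(1) y(1) ey cc by (auto simp: walk_between_def walk_def successively_Cons)
    show "distinct (x # c)" using c(2) xc by simp
    show "3 \<le> length (x # c)" using c' cc by (cases c') auto
    show "{last (x # c), hd (x # c)} \<in> E"
      using c(1) z(1) cc by (auto simp: walk_between_def insert_commute)
  qed
  then show False using T by (auto simp: tree_def)
qed

lemma upper_neighbour_exists:
  assumes T: "tree V E" and r: "r \<in> V" and v: "v \<in> V" "v \<noteq> r"
  shows "\<exists>u. {v, u} \<in> E \<and> depth V E r v = Suc (depth V E r u)"
proof -
  have C: "connected_graph V E" using T by (simp add: tree_def)
  obtain p where p: "walk_between V E r p v" "length p = Suc (depth V E r v)"
    using shortest_walk[OF C r v(1)] by metis
  have p0: "p \<noteq> []" using p by auto
  define q where "q = butlast p"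
  define u where "u = last q"
  have pq: "p = q @ [v]" using p p0 append_butlast_last_id[OF p0]
    by (simp add: q_def walk_between_def)
  have qn: "q \<noteq> []" using p v pq by (auto simp: walk_between_def)
  have wq: "walk_between V E r q u" and e: "{u, v} \<in> E"
    using p(1) qn unfolding pq u_def
    by (auto simp: walk_between_def walk_def successively_append_iff)
  have "length q = Suc (length q - 1)" using qn by (cases q) auto
  then have le: "depth V E r u \<le> length q - 1" by (rule depth_le[OF wq])
  have "depth V E r v \<le> Suc (depth V E r u)"
  proof -
    obtain s where s: "walk_between V E r s u" "length s = Suc (depth V E r u)"
      using shortest_walk[OF C r tree_edge(1)[OF T e]] by metis
    have "walk_between V E r (s @ [v]) v"
      using s(1) e v(1) by (auto simp: walk_between_def walk_def successively_append_iff)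
    then show ?thesis by (rule depth_le) (use s in simp)
  qed
  moreover have "length q = depth V E r v" using p(2) pq by simp
  moreover have "length q > 0" using qn by simp
  ultimately have "depth V E r v = Suc (depth V E r u)" using le by linarith
  then show ?thesis using e by (auto simp: insert_commute)
qed

section \<open>Partitions of label sets\<close>

text \<open>The set \<open>{0..<2 * k * s}\<close> is cut into \<open>2 * k\<close> intervals of length \<open>s\<close>; the block number
  \<open>i < k\<close> consists of the \<open>i\<close>-th interval from below and the \<open>i\<close>-th interval from above, both
  counted from 0. It is the union of \<open>s\<close> pairs \<open>{y, 2 * k * s - 1 - y}\<close>.\<close>

definition blk :: "nat \<Rightarrow> nat \<Rightarrow> nat \<Rightarrow> nat set" where
  "blk s k i = {i * s..<Suc i * s} \<union> {(2 * k - Suc i) * s..<(2 * k - i) * s}"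

lemma intervals_disjoint:
  fixes i j s :: nat
  assumes "i \<noteq> j"
  shows "{i * s..<Suc i * s} \<inter> {j * s..<Suc j * s} = {}"
proof -
  have "y div s = i" if "y \<in> {i * s..<Suc i * s}" for y i
    using that by (intro div_nat_eqI) (auto simp: algebra_simps)
  then show ?thesis using assms by blast
qed

lemma UN_intervals:
  fixes a b s :: nat
  assumes "a \<le> b"
  shows "(\<Union>j\<in>{a..<b}. {j * s..<Suc j * s}) = {a * s..<b * s}"
  using assms
proof (induction b rule: dec_induct)
  case base
  then show ?case by simp
next
  case (step b)
  have "(\<Union>j\<in>{a..<Suc b}. {j * s..<Suc j * s}) =
      (\<Union>j\<in>{a..<b}. {j * s..<Suc j * s}) \<union> {b * s..<Suc b * s}"
    using step.hyps by (auto simp: atLeastLessThanSuc)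
  also have "\<dots> = {a * s..<b * s} \<union> {b * s..<Suc b * s}" by (simp only: step.IH)
  also have "\<dots> = {a * s..<Suc b * s}"
    using step.hyps by (intro ivl_disj_un_two(3)) simp_all
  finally show ?case .
qed

lemma blk_alt: "i < k \<Longrightarrow> blk s k i = (\<Union>j\<in>{i, 2 * k - Suc i}. {j * s..<Suc j * s})"
  using Suc_diff_Suc[of i "2 * k"] by (simp only: blk_def UN_insert UN_empty Un_empty_right)

lemma finite_blk: "finite (blk s k i)"
  by (simp add: blk_def)

lemma blk_disjoint:
  assumes "i < k" "j < k" "i \<noteq> j"
  shows "blk s k i \<inter> blk s k j = {}"
proof -
  have "{a * s..<Suc a * s} \<inter> {b * s..<Suc b * s} = {}"
    if "a \<in> {i, 2 * k - Suc i}" "b \<in> {j, 2 * k - Suc j}" for a b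
    using assms that by (intro intervals_disjoint) auto
  then show ?thesis unfolding blk_alt[OF assms(1)] blk_alt[OF assms(2)] by blast
qed

lemma card_blk:
  assumes "i < k"
  shows "card (blk s k i) = 2 * s"
proof -
  have "{i * s..<Suc i * s} \<inter> {(2 * k - Suc i) * s..<Suc (2 * k - Suc i) * s} = {}"
    using assms by (intro intervals_disjoint) auto
  then show ?thesis unfolding blk_alt[OF assms]
    by (simp add: card_Un_disjoint)
qed

lemma UN_blk:
  assumes "l \<le> k"
  shows "(\<Union>i\<in>{l..<k}. blk s k i) = {l * s..<(2 * k - l) * s}"
proof -
  have "(\<Union>i\<in>{l..<k}. {i, 2 * k - Suc i}) = {l..<2 * k - l}"
  proof (intro equalityI subsetI)
    fix j assume j: "j \<in> {l..<2 * k - l}"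
    show "j \<in> (\<Union>i\<in>{l..<k}. {i, 2 * k - Suc i})"
    proof (cases "j < k")
      case False
      with j have "2 * k - Suc j \<in> {l..<k}" "j = 2 * k - Suc (2 * k - Suc j)" by auto
      then show ?thesis by blast
    qed (use j in auto)
  qed auto
  then have "(\<Union>j\<in>{l..<2 * k - l}. {j * s..<Suc j * s}) = (\<Union>i\<in>{l..<k}. blk s k i)"
    by (auto simp: blk_alt)
  then show ?thesis using UN_intervals[of l "2 * k - l" s] assms by simp
qed

lemma sum_interval: "2 * \<Sum>{a..<a + s} + s = s * (2 * a + s)" for a s :: nat
  by (induction s) (auto simp: algebra_simps)

lemma sum_blk:
  assumes "i < k"
  shows "\<Sum>(blk s k i) + s = 2 * k * s * s"
proof -
  let ?j = "2 * k - Suc i"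
  have "{i * s..<Suc i * s} \<inter> {?j * s..<Suc ?j * s} = {}"
    using assms by (intro intervals_disjoint) auto
  then have "\<Sum>(blk s k i) = \<Sum>{i * s..<i * s + s} + \<Sum>{?j * s..<?j * s + s}"
    unfolding blk_alt[OF assms] by (simp add: sum.union_disjoint add.commute)
  then have "2 * (\<Sum>(blk s k i) + s) = s * (2 * (i * s) + s) + s * (2 * (?j * s) + s)"
    using sum_interval[of "i * s" s] sum_interval[of "?j * s" s]
    by (simp only: distrib_left mult_2)
  also have "\<dots> = 2 * s * s * (i + ?j + 1)" by (simp add: algebra_simps)
  also have "i + ?j + 1 = 2 * k" using assms by simp
  finally have "2 * (\<Sum>(blk s k i) + s) = 2 * (2 * k * s * s)" by (simp add: mult_ac)
  then show ?thesis by simp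
qed

text \<open>The numbers below \<open>4 * h\<close> are split into \<open>2 * h\<close> pairs. The sum of pair number \<open>x\<close> is, up to a
  constant, \<open>- x\<close> for even \<open>x\<close> and \<open>1 - x\<close> for odd \<open>x\<close>: together with the row
  \<open>0, ..., 2 * h - 1\<close> this is an array with three rows whose column sums take two consecutive
  values, which is best possible for an even number of columns.\<close>

lemma kotzig_pairs:
  fixes h :: nat
  shows "\<exists>P. (\<forall>x<2 * h. card (P x) = 2 \<and> \<Sum>(P x) + x + 2 = 5 * h + x mod 2) \<and>
    disjoint_family_on P {..<2 * h} \<and> (\<Union>x<2 * h. P x) = {..<4 * h}"
proof -
  \<comment> \<open>\<open>\<phi> y\<close> is the number of the pair that contains \<open>y\<close>; disjointness is then immediate.\<close>
  define \<phi> where "\<phi> y = (if y < h then 2 * (h - 1 - y) else if y < 2 * h then 2 * (2 * h - 1 - y) + 1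
    else if y < 3 * h then 2 * (3 * h - 1 - y) + 1 else 2 * (4 * h - 1 - y))" for y
  define P where "P x = {y. y < 4 * h \<and> \<phi> y = x}" for x
  have \<phi>_even: "y < 4 * h \<and> \<phi> y = 2 * i \<longleftrightarrow> y = h - 1 - i \<or> y = 4 * h - 1 - i" if "i < h" for i y
  proof -
    consider "y < h" | "h \<le> y" "y < 2 * h" | "2 * h \<le> y" "y < 3 * h" | "3 * h \<le> y" by linarith
    then show ?thesis
    proof cases
      case 1 then show ?thesis using that by (simp add: \<phi>_def) arith
    next
      case 2
      have "\<phi> y \<noteq> 2 * i" using 2 by (simp add: \<phi>_def) presburger
      with 2 show ?thesis using that by auto
    next
      case 3
      have "\<phi> y \<noteq> 2 * i" using 3 by (simp add: \<phi>_def) presburger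
      with 3 show ?thesis using that by auto
    next
      case 4 then show ?thesis using that by (simp add: \<phi>_def) arith
    qed
  qed
  have \<phi>_odd: "y < 4 * h \<and> \<phi> y = 2 * i + 1 \<longleftrightarrow> y = 2 * h - 1 - i \<or> y = 3 * h - 1 - i" if "i < h" for i y
  proof -
    consider "y < h" | "h \<le> y" "y < 2 * h" | "2 * h \<le> y" "y < 3 * h" | "3 * h \<le> y" by linarith
    then show ?thesis
    proof cases
      case 1
      have "\<phi> y \<noteq> 2 * i + 1" using 1 by (simp add: \<phi>_def) presburger
      with 1 show ?thesis using that by auto
    next
      case 2 then show ?thesis using that by (simp add: \<phi>_def) arith
    next
      case 3 then show ?thesis using that by (simp add: \<phi>_def) arith
    next
      case 4
      have "\<phi> y \<noteq> 2 * i + 1" using 4 by (simp add: \<phi>_def) presburger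
      with 4 show ?thesis using that by auto
    qed
  qed
  have "card (P x) = 2 \<and> \<Sum>(P x) + x + 2 = 5 * h + x mod 2" if x: "x < 2 * h" for x
  proof (cases "even x")
    case True
    then obtain i where i: "x = 2 * i" by blast
    have "P x = {h - 1 - i, 4 * h - 1 - i}"
      using \<phi>_even[of i] x unfolding i P_def by auto
    moreover have "h - 1 - i \<noteq> 4 * h - 1 - i" using x i by linarith
    ultimately show ?thesis using x i by simp
  next
    case False
    then obtain i where i: "x = 2 * i + 1" using oddE by blast
    have "P x = {2 * h - 1 - i, 3 * h - 1 - i}"
      using \<phi>_odd[of i] x unfolding i P_def by auto
    moreover have "2 * h - 1 - i \<noteq> 3 * h - 1 - i" using x i by linarith
    ultimately show ?thesis using x i by simp
  qed
  moreover have "disjoint_family_on P {..<2 * h}"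
    by (auto simp: disjoint_family_on_def P_def)
  moreover have "(\<Union>x<2 * h. P x) = {..<4 * h}"
  proof -
    have "\<phi> y < 2 * h" if "y < 4 * h" for y using that by (simp add: \<phi>_def) linarith
    then show ?thesis by (auto simp: P_def)
  qed
  ultimately show ?thesis by blast
qed

text \<open>The pairs of \<open>kotzig_pairs\<close> are enlarged to sets of size \<open>2 * s\<close> by blocks of constant sum.\<close>

lemma leaf_label_sets:
  fixes s m :: nat
  assumes "even m" "0 < s"
  shows "\<exists>S C. (\<forall>x<m. card (S x) = 2 * s \<and> \<Sum>(S x) + x = C + x mod 2) \<and>
    disjoint_family_on S {..<m} \<and> (\<Union>x<m. S x) = {..<2 * s * m}"
proof -
  obtain h where h: "m = 2 * h" using assms by blast
  obtain s' where s': "s = Suc s'" using assms gr0_implies_Suc by blast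
  obtain P where P: "\<forall>x<2 * h. card (P x) = 2 \<and> \<Sum>(P x) + x + 2 = 5 * h + x mod 2"
    "disjoint_family_on P {..<2 * h}" "(\<Union>x<2 * h. P x) = {..<4 * h}"
    using kotzig_pairs[of h] by blast
  have Pm: "P x \<subseteq> {..<2 * m}" if "x < m" for x
    using P(3) that h by (auto simp: set_eq_iff)
  define Q where "Q x = (+) (2 * m) ` blk s' m x" for x
  define S where "S x = P x \<union> Q x" for x
  have Qm: "Q x \<inter> {..<2 * m} = {}" for x by (auto simp: Q_def)
  have PQ: "P x \<inter> Q y = {}" if "x < m" for x y using Pm[OF that] Qm[of y] by blast
  have fin: "finite (P x)" "finite (Q x)" if "x < m" for x
    using Pm[OF that] finite_subset by (auto simp: Q_def finite_blk)
  define C where "C = 5 * h + 4 * s' * m + 2 * m * s' * s' - s' - 2"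
  have "card (S x) = 2 * s \<and> \<Sum>(S x) + x = C + x mod 2" if x: "x < m" for x
  proof
    have "card (Q x) = 2 * s'" using x by (simp add: Q_def card_image card_blk)
    then show "card (S x) = 2 * s"
      using P(1) fin[OF x] PQ[OF x] x h s' by (simp add: S_def card_Un_disjoint)
    have "\<Sum>(Q x) = 2 * s' * (2 * m) + \<Sum>(blk s' m x)"
      using x by (simp add: Q_def sum.reindex sum.distrib card_blk)
    then have "\<Sum>(Q x) + s' = 4 * s' * m + 2 * m * s' * s'"
      using sum_blk[OF x, of s'] by simp
    moreover have "\<Sum>(S x) = \<Sum>(P x) + \<Sum>(Q x)"
      using fin[OF x] PQ[OF x] by (simp add: S_def sum.union_disjoint)
    moreover have "\<Sum>(P x) + x + 2 = 5 * h + x mod 2" using P(1) x h by blast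
    moreover have "s' \<le> 2 * m * s' * s'" using mult_le_mono2[of 1 "2 * m * s'" s'] x
      by (cases "s' = 0") (auto simp: mult_ac)
    moreover have "2 \<le> 5 * h" using x h by auto
    ultimately show "\<Sum>(S x) + x = C + x mod 2" unfolding C_def by linarith
  qed
  moreover have "disjoint_family_on S {..<m}"
  proof -
    have "P x \<inter> P y = {}" "Q x \<inter> Q y = {}" if "x < m" "y < m" "x \<noteq> y" for x y
      using P(2) blk_disjoint[OF that, of s'] that h by (auto simp: disjoint_family_on_def Q_def)
    then show ?thesis using PQ unfolding disjoint_family_on_def S_def by blast
  qed
  moreover have "(\<Union>x<m. S x) = {..<2 * s * m}"
  proof -
    have "(\<Union>x<m. Q x) = (+) (2 * m) ` (\<Union>x\<in>{0..<m}. blk s' m x)"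
      by (simp add: Q_def image_UN lessThan_atLeast0)
    also have "\<dots> = (+) (2 * m) ` {0..<2 * m * s'}" using UN_blk[of 0 m s'] by simp
    also have "\<dots> = {2 * m..<2 * s * m}" by (simp add: s' algebra_simps)
    finally have "(\<Union>x<m. S x) = {..<2 * m} \<union> {2 * m..<2 * s * m}"
      using P(3) h by (simp add: S_def UN_Un_distrib)
    also have "\<dots> = {..<2 * s * m}" using s' by (intro ivl_disj_un) simp
    finally show ?thesis .
  qed
  ultimately show ?thesis by blast
qed

section \<open>Trees presented by a parent function\<close>

text \<open>A complete full \<open>t\<close>-ary tree of height \<open>n\<close>, given by its root, its parent map and the depths of
  its vertices. The edges are the pairs \<open>{v, par v}\<close> for the vertices \<open>v\<close> other than the root;
  \<open>par r\<close> is arbitrary and has no meaning. The leaves are the vertices of depth \<open>n\<close>.\<close>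

locale level_tree =
  fixes V :: "'a set" and E :: "'a set set" and r :: 'a
    and par :: "'a \<Rightarrow> 'a" and dep :: "'a \<Rightarrow> nat" and n t :: nat
  assumes finite_V: "finite V" and root: "r \<in> V"
    and par_in: "v \<in> V - {r} \<Longrightarrow> par v \<in> V"
    and dep_par: "v \<in> V - {r} \<Longrightarrow> dep v = Suc (dep (par v))"
    and edges: "E = (\<lambda>v. {v, par v}) ` (V - {r})"
    and card_children: "v \<in> V \<Longrightarrow> dep v < n \<Longrightarrow> card {u \<in> V - {r}. par u = v} = t"
    and dep_le: "v \<in> V \<Longrightarrow> dep v \<le> n"
    and dep_root: "dep r = 0" and n_pos: "0 < n" and t2: "2 \<le> t"
begin

text \<open>The children of a vertex.\<close>

definition ch :: "'a \<Rightarrow> 'a set" where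
  "ch v = {u \<in> V - {r}. par u = v}"

text \<open>The edge from a vertex \<open>v\<close> other than the root to its parent.\<close>

definition edge :: "'a \<Rightarrow> 'a set" where
  "edge v = {v, par v}"

lemma edge_inj: "inj_on edge (V - {r})"
proof (rule inj_onI)
  fix u v assume "u \<in> V - {r}" "v \<in> V - {r}" "edge u = edge v"
  then show "u = v" using dep_par[of u] dep_par[of v]
    by (auto simp: edge_def doubleton_eq_iff)
qed

lemma bij_edge: "bij_betw edge (V - {r}) E"
  using edge_inj by (simp add: bij_betw_def edges edge_def)

lemma card_E: "card E = card (V - {r})"
  using bij_betw_same_card[OF bij_edge] by simp

lemma finite_ch: "finite (ch v)"
  using finite_V by (simp add: ch_def)

lemma card_ch: "v \<in> V \<Longrightarrow> dep v < n \<Longrightarrow> card (ch v) = t"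
  using card_children by (simp add: ch_def)

lemma dep_ch: "u \<in> ch v \<Longrightarrow> dep u = Suc (dep v)"
  using dep_par by (auto simp: ch_def)

lemma ch_bottom: "v \<in> V \<Longrightarrow> dep v = n \<Longrightarrow> ch v = {}"
  using dep_ch dep_le by (fastforce simp: ch_def)

lemma dep_pos: "v \<in> V - {r} \<Longrightarrow> 0 < dep v"
  using dep_par by simp

lemma incident:
  assumes "v \<in> V"
  shows "incident_edges E v = edge ` (ch v \<union> (if v = r then {} else {v}))"
  using assms by (auto simp: incident_edges_def edges ch_def edge_def)

lemma UN_ch: "(\<Union>v\<in>{v \<in> V. Q (Suc (dep v))}. ch v) = {u \<in> V - {r}. Q (dep u)}"
  using par_in dep_par by (auto simp: ch_def)

lemma self_notin_ch: "v \<notin> ch v"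
  using dep_ch by fastforce

lemma sum_incident:
  assumes "v \<in> V"
  shows "(\<Sum>e\<in>incident_edges E v. (f e :: nat)) =
    (\<Sum>u\<in>ch v. f (edge u)) + (if v = r then 0 else f (edge v))"
proof -
  have "inj_on edge (ch v \<union> (if v = r then {} else {v}))"
    using assms by (intro inj_on_subset[OF edge_inj]) (auto simp: ch_def)
  then have "(\<Sum>e\<in>incident_edges E v. f e) =
      (\<Sum>u\<in>ch v \<union> (if v = r then {} else {v}). f (edge u))"
    by (simp add: incident[OF assms] sum.reindex)
  then show ?thesis using self_notin_ch[of v] finite_ch[of v] by simp
qed

lemma leaves_eq: "leaves V E = {v \<in> V. dep v = n}"
proof -
  have "degree E v = card (ch v) + (if v = r then 0 else 1)" if "v \<in> V" for v
    using sum_incident[OF that, of "\<lambda>_. 1"] by (simp add: degree_def)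
  moreover have "card (ch v) = (if dep v = n then 0 else t)" if "v \<in> V" for v
    using that dep_le[OF that] ch_bottom card_ch by auto
  ultimately have "degree E v = 1 \<longleftrightarrow> dep v = n" if "v \<in> V" for v
    using that t2 dep_root n_pos by auto
  then show ?thesis by (auto simp: leaves_def)
qed

lemma weight_leaf:
  assumes "v \<in> leaves V E"
  shows "weight E f v = f (edge v)"
proof -
  have "v \<in> V" "dep v = n" "v \<noteq> r" using assms leaves_eq dep_root n_pos by auto
  then show ?thesis by (simp add: weight_def sum_incident ch_bottom)
qed

lemma leaves_nonroot: "leaves V E \<subseteq> V - {r}"
  using leaves_eq dep_root n_pos by auto

lemma label_less_children_sum:
  fixes g :: "'a \<Rightarrow> nat"
  assumes pos: "\<And>u. u \<in> V - {r} \<Longrightarrow> 0 < g u" and v: "v \<in> V - {r}"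
  shows "g v < (\<Sum>u\<in>ch (par v). g u)"
proof -
  have "dep (par v) < n" using dep_par[OF v] dep_le[of v] v by simp
  then have "card (ch (par v)) = t" using card_ch par_in v by simp
  then have "ch (par v) \<noteq> {v}" using t2 by auto
  moreover have vc: "v \<in> ch (par v)" using v by (simp add: ch_def)
  ultimately obtain x where x: "x \<in> ch (par v)" "x \<noteq> v" by blast
  have "0 < g x" using x pos by (simp add: ch_def)
  moreover have "g v + g x \<le> (\<Sum>u\<in>ch (par v). g u)"
    using sum_mono2[OF finite_ch, of "{v, x}" "par v" g] x vc by simp
  ultimately show ?thesis by linarith
qed

text \<open>The leaves receive distinct colours, all at most \<open>card E\<close>, while the upper endpoint of the
  edge labelled \<open>card E\<close> has a larger weight.\<close>

lemma card_colours_ge: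
  assumes f: "local_antimagic E f" and ne: "E \<noteq> {}"
  shows "card (leaves V E) + 1 \<le> card (weight E f ` V)"
proof -
  let ?q = "card E"
  have bf: "bij_betw f E {1..?q}" using f by (simp add: local_antimagic_def)
  have fE: "finite E" using finite_V edges by simp
  have bfe: "bij_betw (\<lambda>v. f (edge v)) (V - {r}) {1..?q}"
    using bij_betw_trans[OF bij_edge bf] by (simp add: comp_def)
  have "?q \<in> {1..?q}" using fE ne by (simp add: Suc_le_eq card_gt_0_iff)
  then have "?q \<in> (\<lambda>v. f (edge v)) ` (V - {r})"
    unfolding bij_betw_imp_surj_on[OF bfe] .
  then obtain v where v: "v \<in> V - {r}" "f (edge v) = ?q" by (metis imageE)
  let ?u = "par v"
  have u: "?u \<in> V" "dep ?u < n" using v par_in dep_par dep_le[of v] by auto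
  have "0 < f (edge x)" if "x \<in> V - {r}" for x
    using bspec[OF bij_betwE[OF bfe] that] by simp
  from label_less_children_sum[where g = "\<lambda>x. f (edge x)", OF this v(1)] have big: "?q < weight E f ?u"
    using v(2) by (simp add: weight_def sum_incident[OF u(1)])
  have small: "weight E f w \<le> ?q" if "w \<in> leaves V E" for w
    using that weight_leaf[OF that, of f] leaves_nonroot bfe by (force simp: bij_betw_def)
  have "inj_on (weight E f) (leaves V E)"
    using bij_betw_imp_inj_on[OF bfe] leaves_nonroot weight_leaf[of _ f]
    by (auto simp: inj_on_def subset_iff)
  then have "card (leaves V E) = card (weight E f ` leaves V E)" by (simp add: card_image)
  also have "\<dots> + 1 = card (insert (weight E f ?u) (weight E f ` leaves V E))"
    using small big finite_V leaves_eq by (subst card_insert_disjoint) force+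
  also have "\<dots> \<le> card (weight E f ` V)"
    using u finite_V leaves_eq by (intro card_mono) auto
  finally show ?thesis .
qed

text \<open>A labelling of the edges may be given as a labelling \<open>g\<close> of their lower endpoints.\<close>

lemma labelling_transfer:
  assumes g: "bij_betw g (V - {r}) {1..card E}"
    and proper: "\<And>v. v \<in> V - {r} \<Longrightarrow>
      (\<Sum>u\<in>ch v. g u) + g v \<noteq> (\<Sum>u\<in>ch (par v). g u) + (if par v = r then 0 else g (par v))"
  obtains f where "local_antimagic E f"
    "\<And>v. v \<in> V \<Longrightarrow> weight E f v = (\<Sum>u\<in>ch v. g u) + (if v = r then 0 else g v)"
proof -
  define f where "f = g \<circ> the_inv_into (V - {r}) edge"
  have fe: "f (edge v) = g v" if "v \<in> V - {r}" for v
    using that edge_inj by (simp add: f_def the_inv_into_f_f)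
  have w: "weight E f v = (\<Sum>u\<in>ch v. g u) + (if v = r then 0 else g v)" if "v \<in> V" for v
  proof -
    have "(\<Sum>u\<in>ch v. f (edge u)) = (\<Sum>u\<in>ch v. g u)"
      by (rule sum.cong) (auto simp: ch_def intro!: fe)
    then show ?thesis using that fe[of v] by (simp add: weight_def sum_incident)
  qed
  have "bij_betw f E {1..card E}"
    unfolding f_def by (rule bij_betw_trans[OF bij_betw_the_inv_into[OF bij_edge] g])
  moreover have wp: "weight E f v \<noteq> weight E f (par v)" if "v \<in> V - {r}" for v
    using proper[OF that] that w[of v] w[OF par_in[OF that]] by auto
  have "weight E f u \<noteq> weight E f v" if e: "{u, v} \<in> E" for u v
  proof -
    obtain x where "x \<in> V - {r}" "{u, v} = {x, par x}" using e edges by auto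
    then show ?thesis using wp[of x] by (auto simp: doubleton_eq_iff)
  qed
  ultimately have "local_antimagic E f" by (simp add: local_antimagic_def)
  then show ?thesis using that w by blast
qed

lemma dep_0: "v \<in> V \<Longrightarrow> dep v = 0 \<Longrightarrow> v = r"
  using dep_pos[of v] by auto

lemma finite_nonroot: "finite (V - {r})"
  using finite_V by simp

text \<open>A family of label sets, one for each vertex of \<open>S\<close>, can be realized on the children.\<close>

lemma label_children:
  assumes S: "S \<subseteq> V" "\<And>v. v \<in> S \<Longrightarrow> dep v < n"
    and B: "\<And>v. v \<in> S \<Longrightarrow> card (B v) = t" "disjoint_family_on B S"
  shows "\<exists>g. bij_betw g (\<Union>v\<in>S. ch v) (\<Union>v\<in>S. B v) \<and>
    (\<forall>v\<in>S. bij_betw g (ch v) (B v))"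
proof -
  have "\<exists>\<beta>. bij_betw \<beta> (ch v) (B v)" if "v \<in> S" for v
  proof (rule finite_same_card_bij)
    show "finite (B v)" using B(1)[OF that] t2 by (intro card_ge_0_finite) simp
    show "card (ch v) = card (B v)" using card_ch S B(1) that by auto
  qed (rule finite_ch)
  then obtain \<beta> where \<beta>: "\<And>v. v \<in> S \<Longrightarrow> bij_betw (\<beta> v) (ch v) (B v)" by metis
  define g where "g u = \<beta> (par u) u" for u
  have "bij_betw g (ch v) (B v)" if "v \<in> S" for v
  proof -
    have "bij_betw g (ch v) (B v) \<longleftrightarrow> bij_betw (\<beta> v) (ch v) (B v)"
      by (rule bij_betw_cong) (simp add: g_def ch_def)
    then show ?thesis using \<beta>[OF that] by simp
  qed
  moreover from this have "bij_betw g (\<Union>v\<in>S. ch v) (\<Union>v\<in>S. B v)"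
    by (rule bij_betw_UNION_disjoint[OF B(2)])
  ultimately show ?thesis by blast
qed

section \<open>Labellings with few colours\<close>

lemma star_labelling:
  assumes n: "n = 1"
  shows "\<exists>f. local_antimagic E f \<and> card (weight E f ` V) \<le> card (leaves V E) + 2"
proof -
  have "card (V - {r}) = card {1..card E}" by (simp add: card_E)
  from finite_same_card_bij[OF finite_nonroot finite_atLeastAtMost this]
  obtain g where g: "bij_betw g (V - {r}) {1..card E}" ..
  have g_pos: "0 < g v" if "v \<in> V - {r}" for v
    using bspec[OF bij_betwE[OF g] that] by simp
  have dep_n: "dep v = n" if "v \<in> V - {r}" for v
    using dep_pos[OF that] dep_le[of v] that n by simp
  have par_r: "par v = r" if "v \<in> V - {r}" for v
    using dep_n[OF that] dep_par[OF that] n by (intro dep_0 par_in that) simp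
  have "(\<Sum>u\<in>ch v. g u) + g v \<noteq>
      (\<Sum>u\<in>ch (par v). g u) + (if par v = r then 0 else g (par v))" if "v \<in> V - {r}" for v
    using that label_less_children_sum[where g = g, OF g_pos that] ch_bottom[of v]
      dep_n[OF that] par_r[OF that] by simp
  from labelling_transfer[OF g this] obtain f where f: "local_antimagic E f" by blast
  have "card (weight E f ` V) \<le> card V" using finite_V by (rule card_image_le)
  also have "V \<subseteq> insert r (leaves V E)"
    using dep_n by (auto simp: leaves_eq)
  then have "card V \<le> card (insert r (leaves V E))"
    using finite_V by (intro card_mono) (auto simp: leaves_eq)
  also have "\<dots> \<le> card (leaves V E) + 2"
    by (simp add: card_insert_if finite_V leaves_eq)
  finally show ?thesis using f by blast
qed

text \<open>For the labelling, \<open>Up0\<close>, \<open>Up1\<close> and \<open>L\<close> are the sets of vertices of depth less than \<open>n - 2\<close>,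
  equal to \<open>n - 2\<close>, and equal to \<open>n - 1\<close>; \<open>J\<close> is the set of all internal vertices other than
  the root, which stand for the \<open>U\<close> non-leaf edges.\<close>

lemma deep_labelling:
  assumes n: "2 \<le> n" and t: "t = 2 * s"
  shows "\<exists>f. local_antimagic E f \<and> card (weight E f ` V) \<le> card (leaves V E) + 2"
proof -
  define Up0 where "Up0 = {v \<in> V. Suc (Suc (dep v)) < n}"
  define Up1 where "Up1 = {v \<in> V. Suc (Suc (dep v)) = n}"
  define Up where "Up = Up0 \<union> Up1"
  define L where "L = {v \<in> V. Suc (dep v) = n}"
  define J where "J = {v \<in> V - {r}. dep v < n}"
  have Up: "Up = {v \<in> V. Suc (dep v) < n}" by (auto simp: Up_def Up0_def Up1_def)
  have s: "0 < s" using t t2 by simp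
  have fin: "finite Up0" "finite Up1" "finite Up" "finite L" "finite J"
    using finite_V by (auto simp: Up_def Up0_def Up1_def L_def J_def)
  have J_UN: "J = (\<Union>v\<in>Up. ch v)"
    unfolding J_def Up by (rule UN_ch[symmetric])
  have L_UN: "L = (\<Union>v\<in>Up1. ch v)"
    unfolding Up1_def UN_ch[where Q = "\<lambda>d. Suc d = n"] using dep_root n by (auto simp: L_def)
  have leaves_UN: "leaves V E = (\<Union>v\<in>L. ch v)"
    unfolding L_def UN_ch[where Q = "\<lambda>d. d = n"] using leaves_nonroot by (auto simp: leaves_eq)
  have LJ: "L \<subseteq> J" using dep_root n by (auto simp: L_def J_def)
  define k0 where "k0 = card Up0"
  define k where "k = k0 + card Up1"
  define U where "U = 2 * s * k"
  define m where "m = 2 * s * card Up1"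
  \<comment> \<open>The vertices of depth \<open>n - 2\<close> come last in the enumeration \<open>e\<close>, so that their children, the
    vertices in \<open>L\<close>, get the innermost blocks, which fill an interval of length \<open>m\<close>.\<close>
  obtain e0 where e0: "bij_betw e0 Up0 {0..<k0}"
    using ex_bij_betw_finite_nat[OF fin(1)] k0_def by blast
  have "card Up1 = card {k0..<k}" by (simp add: k_def)
  from finite_same_card_bij[OF fin(2) finite_atLeastLessThan this]
  obtain e1 where e1: "bij_betw e1 Up1 {k0..<k}" ..
  define e where "e v = (if v \<in> Up0 then e0 v else e1 v)" for v
  have e_Up0: "bij_betw e Up0 {0..<k0}"
    using e0 by (subst bij_betw_cong[of _ _ e0]) (auto simp: e_def)
  have e_Up1: "bij_betw e Up1 {k0..<k}"
    using e1 by (subst bij_betw_cong[of _ _ e1]) (auto simp: e_def Up0_def Up1_def)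
  have e_Up: "bij_betw e Up {0..<k}"
    using bij_betw_combine[OF e_Up0 e_Up1] by (simp add: Up_def k_def ivl_disj_un ivl_disj_int)
  have e_less: "e v < k" if "v \<in> Up" for v
    using e_Up that by (auto simp: bij_betw_def)

  \<comment> \<open>Blocks start at 0, labels at 1.\<close>
  define B where "B v = Suc ` blk s k (e v)" for v
  have Up_V: "Up \<subseteq> V" and Up_dep: "\<And>v. v \<in> Up \<Longrightarrow> dep v < n" by (auto simp: Up)
  have B_card: "card (B v) = t" if "v \<in> Up" for v
    using card_blk[OF e_less[OF that]] by (simp add: B_def card_image t)
  have B_disj: "disjoint_family_on B Up"
    unfolding disjoint_family_on_def
  proof (intro ballI impI)
    fix v w assume "v \<in> Up" "w \<in> Up" "v \<noteq> w"
    then have "blk s k (e v) \<inter> blk s k (e w) = {}"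
      using e_Up e_less by (intro blk_disjoint) (auto simp: bij_betw_def inj_on_def)
    then show "B v \<inter> B w = {}" by (auto simp: B_def)
  qed
  obtain g1 where g1: "bij_betw g1 J (\<Union>v\<in>Up. B v)"
    and g1_all: "\<forall>v\<in>Up. bij_betw g1 (ch v) (B v)"
    using label_children[OF Up_V Up_dep B_card B_disj] unfolding J_UN by blast
  note g1_ch = bspec[OF g1_all]
  have "(\<Union>v\<in>Up. B v) = Suc ` (\<Union>i\<in>{0..<k}. blk s k i)"
    by (simp add: B_def image_UN flip: bij_betw_imp_surj_on[OF e_Up])
  also have "\<dots> = {1..U}"
    by (simp add: UN_blk U_def mult_ac image_Suc_atLeastLessThan atLeastLessThanSuc_atLeastAtMost)
  finally have g1_J: "bij_betw g1 J {1..U}" using g1 by simp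
  have "(\<Union>v\<in>Up1. B v) = Suc ` (\<Union>i\<in>{k0..<k}. blk s k i)"
    by (simp add: B_def image_UN flip: bij_betw_imp_surj_on[OF e_Up1])
  also have "\<dots> = Suc ` {k0 * s..<(2 * k - k0) * s}"
    by (subst UN_blk) (simp_all add: k_def)
  also have "(2 * k - k0) * s = k0 * s + m"
  proof -
    have "2 * k - k0 = k0 + 2 * card Up1" by (simp add: k_def)
    then show ?thesis by (simp add: m_def algebra_simps)
  qed
  finally have B_Up1: "(\<Union>v\<in>Up1. B v) = Suc ` {k0 * s..<k0 * s + m}" .
  have g1_L: "bij_betw g1 L (Suc ` {k0 * s..<k0 * s + m})"
    unfolding L_UN B_Up1[symmetric]
    using g1_ch disjoint_family_on_mono[OF _ B_disj, of Up1]
    by (intro bij_betw_UNION_disjoint) (auto simp: Up_def)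
  define x where "x v = g1 v - Suc (k0 * s)" for v
  have g1_x: "g1 v = x v + k0 * s + 1" "x v < m" if "v \<in> L" for v
    using bij_betwE[OF g1_L] that by (auto simp: x_def)
  have x_bij: "bij_betw x L {..<m}"
  proof (rule bij_betw_imageI)
    show "inj_on x L" using g1_x bij_betw_imp_inj_on[OF g1_L] by (auto simp: inj_on_def)
    have "x ` L = (\<lambda>y. y - Suc (k0 * s)) ` (g1 ` L)" by (auto simp: x_def image_image)
    also have "\<dots> = {..<m}"
      unfolding bij_betw_imp_surj_on[OF g1_L] image_image
      by (auto simp: image_iff intro!: bexI[of _ "_ + k0 * s"])
    finally show "x ` L = {..<m}" .
  qed

  \<comment> \<open>The sets of leaf labels depend on the position \<open>x v\<close> of the label of \<open>v\<close> in that interval.\<close>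
  obtain S C where S_all: "\<forall>i<m. card (S i) = 2 * s \<and> \<Sum>(S i) + i = C + i mod 2"
    and S_disj: "disjoint_family_on S {..<m}" and S_UN: "(\<Union>i<m. S i) = {..<2 * s * m}"
    using leaf_label_sets[of m s] s unfolding m_def by auto
  have S: "card (S i) = 2 * s \<and> \<Sum>(S i) + i = C + i mod 2" if "i < m" for i
    using S_all that by blast
  define B' where "B' v = (+) (Suc U) ` S (x v)" for v
  have B'_card: "card (B' v) = t" if "v \<in> L" for v
    using S g1_x(2)[OF that] by (simp add: B'_def card_image inj_on_def t)
  have B'_disj: "disjoint_family_on B' L"
    unfolding disjoint_family_on_def
  proof (intro ballI impI)
    fix v w assume vw: "v \<in> L" "w \<in> L" "v \<noteq> w"
    then have "x v \<noteq> x w" using x_bij by (auto simp: bij_betw_def inj_on_def)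
    then have "S (x v) \<inter> S (x w) = {}"
      using S_disj g1_x(2) vw by (auto simp: disjoint_family_on_def)
    then show "B' v \<inter> B' w = {}" by (auto simp: B'_def)
  qed
  have L_V: "L \<subseteq> V" and L_dep: "\<And>v. v \<in> L \<Longrightarrow> dep v < n" by (auto simp: L_def)
  obtain g2 where g2: "bij_betw g2 (leaves V E) (\<Union>v\<in>L. B' v)"
    and g2_all: "\<forall>v\<in>L. bij_betw g2 (ch v) (B' v)"
    using label_children[OF L_V L_dep B'_card B'_disj] unfolding leaves_UN by blast
  note g2_ch = bspec[OF g2_all]
  have "(\<Union>v\<in>L. B' v) = (+) (Suc U) ` (\<Union>i<m. S i)"
    by (simp add: B'_def image_UN flip: bij_betw_imp_surj_on[OF x_bij])
  also have "\<dots> = {Suc U..U + 2 * s * m}"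
    unfolding S_UN unfolding lessThan_atLeast0 image_add_atLeastLessThan
    by (simp add: atLeastLessThanSuc_atLeastAtMost)
  finally have g2_leaves: "bij_betw g2 (leaves V E) {Suc U..U + 2 * s * m}" using g2 by simp

  define q where "q = U + 2 * s * m"
  define g where "g v = (if dep v < n then g1 v else g2 v)" for v
  have VJ: "V - {r} = J \<union> leaves V E"
    using dep_le leaves_nonroot by (force simp: J_def leaves_eq)
  have g_J: "g v = g1 v" if "v \<in> J" for v using that by (simp add: g_def J_def)
  have g_leaves: "g v = g2 v" if "v \<in> leaves V E" for v using that by (simp add: g_def leaves_eq)
  have g_bij: "bij_betw g (V - {r}) {1..q}"
  proof -
    have "bij_betw g J {1..U}" using g1_J g_J by (subst bij_betw_cong[of _ _ g1]) auto
    moreover have "bij_betw g (leaves V E) {Suc U..U + 2 * s * m}"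
      using g2_leaves g_leaves by (subst bij_betw_cong[of _ _ g2]) auto
    ultimately have "bij_betw g (J \<union> leaves V E) ({1..U} \<union> {Suc U..U + 2 * s * m})"
      by (rule bij_betw_combine) auto
    also have "{1..U} \<union> {Suc U..U + 2 * s * m} = {1..q}" by (auto simp: q_def)
    finally show ?thesis by (simp add: VJ)
  qed
  have q_card: "card E = q" using bij_betw_same_card[OF g_bij] by (simp add: card_E)
  have g_bij': "bij_betw g (V - {r}) {1..card E}" using g_bij q_card by simp
  have g_pos: "0 < g v" if "v \<in> V - {r}" for v
    using bspec[OF bij_betwE[OF g_bij] that] by simp
  \<comment> \<open>There are \<open>U + 1\<close> internal vertices, and \<open>k + m\<close> is another count of them.\<close>
  have q: "q = 2 * s * (U + 1)"
  proof -
    have "card (Up \<union> L) = card Up + card L"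
      using fin by (intro card_Un_disjoint) (auto simp: Up L_def)
    moreover have "Up \<union> L = insert r J"
      using root dep_root n by (auto simp: Up L_def J_def)
    moreover have "card (insert r J) = Suc (card J)" using fin by (simp add: J_def)
    ultimately have "U + 1 = k + m"
      using bij_betw_same_card[OF e_Up] bij_betw_same_card[OF x_bij] bij_betw_same_card[OF g1_J]
      by simp
    then show ?thesis by (simp add: q_def U_def algebra_simps)
  qed

  define w where "w v = (\<Sum>u\<in>ch v. g u) + (if v = r then 0 else g v)" for v
  have g_range: "1 \<le> g v" "g v \<le> U" if "v \<in> J" for v
    using bij_betwE[OF g1_J] g_J[OF that] that by auto
  have w_Up: "w v = s * (U + 1) + (if v = r then 0 else g v)" if v: "v \<in> Up" for v
  proof -
    have "ch v \<subseteq> J" using v J_UN by blast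
    then have "(\<Sum>u\<in>ch v. g u) = (\<Sum>u\<in>ch v. g1 u)" using g_J by (intro sum.cong) auto
    also have "\<dots> = \<Sum>(B v)" by (rule sum.reindex_bij_betw[OF g1_ch[OF v], of "\<lambda>y. y"])
    also have "\<dots> = \<Sum>(blk s k (e v)) + 2 * s"
      using card_blk[OF e_less[OF v]] by (simp add: B_def sum.reindex sum_Suc)
    also have "\<dots> = s * (U + 1)"
      using sum_blk[OF e_less[OF v], of s] by (simp add: U_def algebra_simps)
    finally show ?thesis by (simp add: w_def)
  qed
  define A where "A = 2 * s * (U + 1) + C + k0 * s + 1"
  have w_L: "w v = A + x v mod 2" "w v > q" if v: "v \<in> L" for v
  proof -
    have "ch v \<subseteq> leaves V E" using v leaves_UN by blast
    then have "(\<Sum>u\<in>ch v. g u) = (\<Sum>u\<in>ch v. g2 u)" using g_leaves by (intro sum.cong) auto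
    also have "\<dots> = \<Sum>(B' v)" by (rule sum.reindex_bij_betw[OF g2_ch[OF v], of "\<lambda>y. y"])
    also have "\<dots> = 2 * s * (U + 1) + \<Sum>(S (x v))"
      using S[OF g1_x(2)[OF v]]
      by (simp add: B'_def sum.reindex inj_on_def sum.distrib algebra_simps sum_Suc)
    finally have "w v = 2 * s * (U + 1) + \<Sum>(S (x v)) + (x v + k0 * s + 1)"
      using g1_x(1)[OF v] g_J LJ v by (auto simp: w_def J_def)
    then show "w v = A + x v mod 2" "w v > q"
      using S[OF g1_x(2)[OF v]] by (simp_all add: A_def q)
  qed
  have U_less: "U < s * (U + 1)"
    using mult_le_mono1[of 1 s "U + 1"] s by (simp add: algebra_simps)
  then have Up_le: "s * (U + 1) + U < q" by (simp add: q mult.commute)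
  have w_Up_range: "U < w v" "w v \<le> q" if v: "v \<in> Up" for v
  proof -
    have vJ: "v = r \<or> v \<in> J" using v by (auto simp: Up J_def)
    show "U < w v" using w_Up[OF v] U_less by linarith
    show "w v \<le> q" using w_Up[OF v] Up_le vJ g_range(2)[of v] by (auto split: if_splits)
  qed

  have "w v \<noteq> w (par v)" if v: "v \<in> V - {r}" for v
  proof -
    have p: "par v \<in> V" "dep v = Suc (dep (par v))" using par_in dep_par v by auto
    consider "dep v = n" | "v \<in> L" | "v \<in> Up"
      using dep_le[of v] v by (force simp: L_def Up)
    then show ?thesis
    proof cases
      case 1
      then show ?thesis using label_less_children_sum[where g = g, OF g_pos v] ch_bottom[of v] v
        by (simp add: w_def)
    next
      case 2
      then have "par v \<in> Up" using p by (auto simp: L_def Up)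
      then show ?thesis using w_L(2)[OF 2] w_Up_range(2)[of "par v"] by linarith
    next
      case 3
      then have pU: "par v \<in> Up" using p by (auto simp: Up)
      have vJ: "v \<in> J" using 3 v by (auto simp: Up J_def)
      have "g v \<noteq> (if par v = r then 0 else g (par v))"
        using g_range(1)[OF vJ] inj_onD[OF bij_betw_imp_inj_on[OF g_bij], of v "par v"] p v
        by auto
      then show ?thesis using w_Up[OF 3] w_Up[OF pU] v by simp
    qed
  qed
  then have "(\<Sum>u\<in>ch v. g u) + g v \<noteq>
      (\<Sum>u\<in>ch (par v). g u) + (if par v = r then 0 else g (par v))" if "v \<in> V - {r}" for v
    using that unfolding w_def by simp
  from labelling_transfer[OF g_bij' this] obtain f
    where f: "local_antimagic E f" and fw: "\<And>v. v \<in> V \<Longrightarrow> weight E f v = w v"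
    unfolding w_def by blast
  have "weight E f ` V \<subseteq> weight E f ` leaves V E \<union> {A, A + 1}"
  proof
    fix c assume "c \<in> weight E f ` V"
    then obtain v where v: "v \<in> V" and c: "c = w v" using fw by auto
    consider "v \<in> leaves V E" | "v \<in> L" | "v \<in> Up"
      using dep_le[of v] v by (force simp: L_def Up leaves_eq)
    then show "c \<in> weight E f ` leaves V E \<union> {A, A + 1}"
    proof cases
      case 1
      then show ?thesis unfolding c fw[OF v, symmetric] by blast
    next
      case 2
      have "x v mod 2 = 0 \<or> x v mod 2 = 1" by linarith
      then show ?thesis unfolding c w_L(1)[OF 2] by auto
    next
      case 3
      then have "w v \<in> g2 ` leaves V E"
        using w_Up_range[OF 3] bij_betw_imp_surj_on[OF g2_leaves] by (simp add: q_def)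
      then obtain u where u: "u \<in> leaves V E" "w v = g2 u" by blast
      have "u \<in> V - {r}" using u(1) leaves_nonroot by blast
      then have "c = weight E f u"
        using u c fw[of u] ch_bottom[of u] g_leaves[OF u(1)] by (simp add: w_def leaves_eq)
      then show ?thesis using u(1) by blast
    qed
  qed
  then have "card (weight E f ` V) \<le> card (weight E f ` leaves V E \<union> {A, A + 1})"
    using finite_V by (intro card_mono) (auto simp: leaves_eq)
  also have "\<dots> \<le> card (weight E f ` leaves V E) + card {A, A + 1}" by (rule card_Un_le)
  also have "\<dots> \<le> card (leaves V E) + 2"
    using card_image_le[of "leaves V E" "weight E f"] finite_V by (simp add: leaves_eq)
  finally show ?thesis using f by blast
qed

end

section \<open>Complete full trees and their chromatic number\<close>

lemma complete_full_tree_level_tree: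
  assumes t: "2 \<le> t" and T: "complete_full_tree t V E r" and ne: "E \<noteq> {}"
  obtains par n where "level_tree V E r par (depth V E r) n t"
proof -
  let ?d = "depth V E r"
  have tree: "tree V E" and r: "r \<in> V"
    and ch: "\<And>v. v \<in> V - leaves V E \<Longrightarrow> card (children V E r v) = t"
    and lv: "\<And>u v. u \<in> leaves V E \<Longrightarrow> v \<in> leaves V E \<Longrightarrow> ?d u = ?d v"
    using T unfolding complete_full_tree_def by blast+
  have fV: "finite V" using tree by (simp add: tree_def simple_graph_def)
  obtain par where par: "\<And>v. v \<in> V - {r} \<Longrightarrow> {v, par v} \<in> E \<and> ?d v = Suc (?d (par v))"
    using upper_neighbour_exists[OF tree r] by (metis DiffE insertI1)
  have par_in: "par v \<in> V" if "v \<in> V - {r}" for v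
    using par[OF that] tree_edge(2)[OF tree] by blast
  have upper: "u = par v \<and> v \<in> V - {r}" if e: "{v, u} \<in> E" and le: "?d u \<le> ?d v" for u v
  proof -
    have "v \<noteq> r"
      using le depth_0[OF tree r, of u] depth_root[OF r, of E] tree_edge[OF tree e] by auto
    then have "v \<in> V - {r}" using tree_edge[OF tree e] by simp
    then show ?thesis using upper_neighbour_unique[OF tree r e le] par by simp
  qed
  have E: "E = (\<lambda>v. {v, par v}) ` (V - {r})"
  proof
    show "E \<subseteq> (\<lambda>v. {v, par v}) ` (V - {r})"
    proof
      fix e assume e: "e \<in> E"
      then have "card e = 2" using tree by (simp add: tree_def simple_graph_def)
      then obtain u v where uv: "e = {u, v}" by (auto simp: card_2_iff)
      show "e \<in> (\<lambda>v. {v, par v}) ` (V - {r})"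
      proof (cases "?d u \<le> ?d v")
        case True
        then have "u = par v \<and> v \<in> V - {r}" using upper[of v u] e uv by (simp add: insert_commute)
        then show ?thesis using uv by auto
      next
        case False
        then have "v = par u \<and> u \<in> V - {r}" using upper[of u v] e uv by simp
        then show ?thesis using uv by auto
      qed
    qed
  qed (use par in auto)
  have children: "children V E r v = {u \<in> V - {r}. par u = v}" if "v \<in> V" for v
  proof
    show "children V E r v \<subseteq> {u \<in> V - {r}. par u = v}"
      using upper by (fastforce simp: children_def insert_commute)
    show "{u \<in> V - {r}. par u = v} \<subseteq> children V E r v"
      using par by (auto simp: children_def insert_commute)
  qed
  have pn: "par v \<noteq> v" if "v \<in> V - {r}" for v using par[OF that] by auto
  have inj: "inj_on (\<lambda>v. {v, par v}) (V - {r})"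
  proof (rule inj_onI)
    fix u v assume "u \<in> V - {r}" "v \<in> V - {r}" "{u, par u} = {v, par v}"
    then show "u = v" using par[of u] par[of v] by (auto simp: doubleton_eq_iff)
  qed
  have degree: "degree E v = card (children V E r v) + (if v = r then 0 else 1)"
    if v: "v \<in> V" for v
  proof -
    let ?X = "children V E r v \<union> (if v = r then {} else {v})"
    have "incident_edges E v = (\<lambda>v. {v, par v}) ` ?X"
      using v unfolding children[OF v] by (auto simp: incident_edges_def E)
    moreover have "?X \<subseteq> V - {r}" using v unfolding children[OF v] by auto
    ultimately have "degree E v = card ?X"
      using card_image[OF inj_on_subset[OF inj]] by (simp add: degree_def)
    moreover have "v \<notin> children V E r v" by (simp add: children_def)
    moreover have "finite (children V E r v)" using fV by (simp add: children_def)
    ultimately show ?thesis by simp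
  qed
  \<comment> \<open>A vertex \<open>z\<close> of maximal depth has no children, hence is a leaf; it fixes the depth of all leaves.\<close>
  define n where "n = Max (?d ` V)"
  have le_n: "?d v \<le> n" if "v \<in> V" for v using that fV by (simp add: n_def)
  have "n \<in> ?d ` V" unfolding n_def using fV r by (intro Max_in) auto
  then obtain z where z: "z \<in> V" "?d z = n" by auto
  have "V - {r} \<noteq> {}" using ne E by auto
  then have n0: "0 < n" using le_n par by fastforce
  have zr: "z \<noteq> r" using n0 z depth_root[OF r, of E] by auto
  have "children V E r z = {}" using z le_n by (fastforce simp: children_def)
  then have zl: "z \<in> leaves V E" using degree[OF z(1)] zr z by (simp add: leaves_def)
  have "card {u \<in> V - {r}. par u = v} = t" if v: "v \<in> V" "?d v < n" for v
  proof -
    have "v \<notin> leaves V E" using lv[OF _ zl] v z by auto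
    then show ?thesis using ch[of v] v children by simp
  qed
  then have "level_tree V E r par ?d n t"
    using fV r par_in par E le_n depth_root[OF r] n0 t by unfold_locales auto
  then show ?thesis by (rule that)
qed

theorem theorem5p1:
  fixes t :: nat and V :: "'a set" and E :: "'a set set" and r :: 'a
  assumes "t \<ge> 2" and "even t"
    and "complete_full_tree t V E r"
    and "E \<noteq> {}"
  shows "local_antimagic_chromatic_number V E = card (leaves V E) + 1 \<or>
         local_antimagic_chromatic_number V E = card (leaves V E) + 2"
proof -
  obtain par n where "level_tree V E r par (depth V E r) n t"
    using complete_full_tree_level_tree assms by metis
  then interpret level_tree V E r par "depth V E r" n t .
  let ?N = "{card (weight E f ` V) | f. local_antimagic E f}"
  obtain s where "t = 2 * s" using assms(2) by blast
  then have "\<exists>f. local_antimagic E f \<and> card (weight E f ` V) \<le> card (leaves V E) + 2"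
    using star_labelling deep_labelling n_pos by (cases "n = 1") auto
  then obtain f where f: "local_antimagic E f"
    "card (weight E f ` V) \<le> card (leaves V E) + 2" by blast
  \<comment> \<open>The set is nonempty, so that its infimum is attained by some labelling.\<close>
  have "Inf ?N \<le> card (leaves V E) + 2"
    using f by (intro order_trans[OF cInf_lower f(2)]) auto
  moreover have "Inf ?N \<in> ?N" using f(1) by (intro Inf_nat_def1) blast
  then have "card (leaves V E) + 1 \<le> Inf ?N"
    using card_colours_ge[OF _ assms(4)] by fastforce
  ultimately show ?thesis unfolding local_antimagic_chromatic_number_def by linarith
qed

end
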